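(* Let $\mathcal{J}$ be a nonempty open interval of $\mathbb{R}$ and let $k\ge 0$. The set of all bounded, (everywhere) differentiable, Clarke exhaustive functions $f:\mathcal{J}\to\mathbb{R}$ with $\|f\|_{\mathrm{Lip}}\le k$ is dense in the metric space $\left(\mathrm{Lip}^{[k]}(\mathcal{J}),d_\infty\right)$.
   Context: For a Lipschitz function $f:\mathcal{J}\to\mathbb{R}$, $\|f\|_{\mathrm{Lip}}=\sup_{x\neq y}\frac{|f(x)-f(y)|}{|x-y|}$. $\mathrm{Lip}^{[k]}(\mathcal{J})$ denotes the set of all bounded Lipschitz functions $f:\mathcal{J}\to\mathbb{R}$ with $\|f\|_{\mathrm{Lip}}\le k$, and $d_\infty(f,g)=\sup_{x\in\mathcal{J}}|f(x)-g(x)|$. For a locally Lipschitz $f:\mathcal{J}\to\mathbb{R}$, with $\mathcal{D}_f$ its set of differentiability points, the Clarke subdifferential at $x\in\mathcal{J}$ is $$\partial f(x)=\mathrm{conv}\Big\{\lim_{n\to\infty} f'(x_n)\,:\ x_n\to x,\ \{x_n\}\subset\mathcal{D}_f\setminus\mathcal{N},\ \text{the limit exists}\Big\},$$ where $\mathcal{N}$ is any Lebesgue-null set (the definition does not depend on $\mathcal{N}$). A Lipschitz function $f:\mathcal{J}\to\mathbb{R}$ is called Clarke exhaustive if for every nonempty closed convex subset $K$ of $[-\|f\|_{\mathrm{Lip}},\|f\|_{\mathrm{Lip}}]$ there exists $x\in\mathcal{J}$ with $\partial f(x)=K$. *)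

theory Defs
  imports "HOL-Analysis.Analysis"
begin

text \<open>
  A function on an interval \<open>J\<close> is an element of \<^term>\<open>extensional J\<close>, so that it is determined
  by its values on \<open>J\<close> and the supremum distance is a genuine metric.
\<close>

definition lip_norm :: "real set \<Rightarrow> (real \<Rightarrow> real) \<Rightarrow> real" where
  "lip_norm J f = (SUP (x, y) \<in> {(x, y). x \<in> J \<and> y \<in> J \<and> x \<noteq> y}. \<bar>f x - f y\<bar> / \<bar>x - y\<bar>)"

text \<open>\<^const>\<open>lip_norm\<close> is only meaningful for Lipschitz functions, hence the explicit Lipschitz
  conditions below: the supremum of an unbounded set of reals is unspecified.\<close>

definition Lip_set :: "real \<Rightarrow> real set \<Rightarrow> (real \<Rightarrow> real) set" where
  "Lip_set k J = {f \<in> extensional J. bounded (f ` J) \<and> (\<exists>C. C-lipschitz_on J f) \<and> lip_norm J f \<le> k}"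

text \<open>\<^term>\<open>funspace J euclidean_metric\<close> carries the metric
  \<open>d(f, g) = (SUP x\<in>J. \<bar>f x - g x\<bar>)\<close> on the bounded functions on \<open>J\<close>.\<close>

definition Lip_metric :: "real \<Rightarrow> real set \<Rightarrow> (real \<Rightarrow> real) metric" where
  "Lip_metric k J = submetric (funspace J euclidean_metric) (Lip_set k J)"

text \<open>For open \<open>J\<close>, differentiability and the derivative at a point of \<open>J\<close> depend only on the
  values of \<open>f\<close> on \<open>J\<close>.\<close>

definition diff_points :: "real set \<Rightarrow> (real \<Rightarrow> real) \<Rightarrow> real set" where
  "diff_points J f = {x \<in> J. f differentiable (at x)}"

text \<open>The excluded Lebesgue-null set \<open>N\<close> is kept as a parameter.\<close>

definition clarke_subdifferential ::
    "real set \<Rightarrow> real set \<Rightarrow> (real \<Rightarrow> real) \<Rightarrow> real \<Rightarrow> real set" where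
  "clarke_subdifferential N J f x =
     convex hull {l. \<exists>X :: nat \<Rightarrow> real. X \<longlonglongrightarrow> x \<and> (\<forall>n. X n \<in> diff_points J f - N) \<and>
                       (\<lambda>n. deriv f (X n)) \<longlonglongrightarrow> l}"

definition clarke_exhaustive :: "real set \<Rightarrow> real set \<Rightarrow> (real \<Rightarrow> real) \<Rightarrow> bool" where
  "clarke_exhaustive N J f \<longleftrightarrow>
     (\<exists>C. C-lipschitz_on J f) \<and>
     (\<forall>K. K \<noteq> {} \<and> closed K \<and> convex K \<and> K \<subseteq> {- lip_norm J f .. lip_norm J f} \<longrightarrow>
        (\<exists>x\<in>J. clarke_subdifferential N J f x = K))"

lemma mspace_Lip_metric: "mspace (Lip_metric k J) = Lip_set k J"
  by (auto simp: Lip_metric_def Lip_set_def Met_TC.fspace_def)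

lemma mdist_Lip_metric:
  assumes "J \<noteq> {}" "f \<in> Lip_set k J" "g \<in> Lip_set k J"
  shows "mdist (Lip_metric k J) f g = (SUP x\<in>J. \<bar>f x - g x\<bar>)"
  using assms by (auto simp: Lip_metric_def Lip_set_def Met_TC.fspace_def Met_TC.fdist_def dist_real_def)

end

theory Submission
  imports Defs
begin

text \<open>
  Let \<open>\<alpha>\<^sub>0, \<alpha>\<^sub>1\<close> be continuous with values in \<open>[-k, k]\<close>, and put \<open>m = (\<alpha>\<^sub>0 + \<alpha>\<^sub>1) / 2\<close> and
  \<open>r = \<bar>\<alpha>\<^sub>0 - \<alpha>\<^sub>1\<bar> / 2\<close>. If \<open>M' = m\<close>, and if \<open>h\<close> is everywhere differentiable with \<open>\<bar>h'\<bar> \<le> r\<close> and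
  \<open>h'\<close> comes arbitrarily close to both \<open>r(x)\<close> and \<open>-r(x)\<close> at continuity points of \<open>h'\<close> near \<open>x\<close>, then
  \<open>M + h\<close> has Clarke subdifferential \<open>[m(x) - r(x), m(x) + r(x)]\<close> at \<open>x\<close>, the interval between
  \<open>\<alpha>\<^sub>0(x)\<close> and \<open>\<alpha>\<^sub>1(x)\<close>. Such an \<open>h\<close> exists for all points \<open>x\<close> of the Cantor set simultaneously: put
  in each gap one bump whose width is small compared with the square of the length of the gap.
  Schoenberg's curve maps the Cantor set onto the unit square, so on a rescaled copy of it the pair
  \<open>(\<alpha>\<^sub>0, \<alpha>\<^sub>1)\<close> can be made to take every value in \<open>[-k, k]\<^sup>2\<close>. Given a Lipschitz function, smooth it by
  averaging and modify its derivative in this way on a tiny interval only.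
\<close>

section \<open>Schoenberg's space-filling curve\<close>

text \<open>An even function of period 2 that is 0 on [0, 1/3] and 1 on [2/3, 1], so it turns a
  ternary digit 0 or 2 into a bit. The clamped cosine takes the place of Schoenberg's piecewise
  linear function.\<close>

definition ramp :: "real \<Rightarrow> real" where
  "ramp t = max 0 (min 1 (1/2 - cos (pi * t)))"

text \<open>The coordinates of the curve are \<open>schoenberg 0\<close> and
  \<open>schoenberg 1\<close>; on the Cantor set they read the digits at even and at odd
  positions.\<close>

definition schoenberg :: "nat \<Rightarrow> real \<Rightarrow> real" where
  "schoenberg i t = (\<Sum>n. ramp (3 ^ (2 * n + i) * t) / 2 ^ Suc n)"

fun cantor_digits :: "(nat \<Rightarrow> bool) \<Rightarrow> nat \<Rightarrow> int" where
  "cantor_digits b 0 = 0"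
| "cantor_digits b (Suc n) = 3 * cantor_digits b n + 2 * of_bool (b n)"

text \<open>Nested ternary intervals pin down the point whose ternary digits are twice the bits of
  \<open>b\<close>, without an infinite series.\<close>

definition cantor_point :: "(nat \<Rightarrow> bool) \<Rightarrow> real \<Rightarrow> bool" where
  "cantor_point b x \<longleftrightarrow>
     (\<forall>n. real_of_int (cantor_digits b n) \<le> 3 ^ n * x \<and> 3 ^ n * x \<le> real_of_int (cantor_digits b n) + 1)"

lemma ramp_bounds: "0 \<le> ramp t" "ramp t \<le> 1"
  by (auto simp: ramp_def)

lemma continuous_ramp: "continuous_on A ramp"
  unfolding ramp_def by (intro continuous_intros)

lemma schoenberg_summand_bound: "norm (ramp s / 2 ^ Suc n) \<le> (1/2) ^ Suc n"
  using ramp_bounds[of s] by (simp add: power_one_over divide_right_mono field_simps)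

lemma sums_half_powers: "(\<lambda>n. (1/2::real) ^ Suc n) sums 1"
  using power_half_series by simp

lemma continuous_schoenberg: "continuous_on UNIV (schoenberg i)"
proof -
  have "uniform_limit UNIV (\<lambda>n t. \<Sum>j<n. ramp (3 ^ (2 * j + i) * t) / 2 ^ Suc j)
          (schoenberg i) sequentially"
    unfolding schoenberg_def
    by (rule Weierstrass_m_test[OF schoenberg_summand_bound])
       (use sums_half_powers in \<open>simp add: sums_iff\<close>)
  moreover have "continuous_on UNIV (\<lambda>t. \<Sum>j<n. ramp (3 ^ (2 * j + i) * t) / 2 ^ Suc j)" for n
    by (intro continuous_intros continuous_on_compose2[OF continuous_ramp]) auto
  ultimately show ?thesis
    by (intro uniform_limit_theorem[where F = sequentially]) auto
qed

lemma schoenberg_bounds: "schoenberg i t \<in> {0..1}"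
proof -
  let ?a = "\<lambda>n. ramp (3 ^ (2 * n + i) * t) / 2 ^ Suc n"
  have s: "summable ?a"
  proof (rule summable_comparison_test')
    show "summable (\<lambda>n. (1/2::real) ^ Suc n)" using sums_half_powers by (simp add: sums_iff)
  qed (rule schoenberg_summand_bound)
  have "suminf ?a \<le> (\<Sum>n. (1/2::real) ^ Suc n)"
  proof (rule suminf_le[OF _ s])
    show "?a n \<le> (1/2) ^ Suc n" for n
      using schoenberg_summand_bound unfolding real_norm_def by (rule abs_le_D1)
  qed (use sums_half_powers in \<open>simp add: sums_iff\<close>)
  moreover have "0 \<le> suminf ?a"
    by (rule suminf_nonneg[OF s]) (simp add: ramp_bounds)
  ultimately show ?thesis
    using sums_half_powers by (simp add: schoenberg_def sums_iff)
qed

section \<open>Ternary digits of Cantor points\<close>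

lemma even_cantor_digits: "even (cantor_digits b n)"
  by (induction n) auto

lemma cantor_digits_mod_3: "cantor_digits b n mod 3 \<noteq> 1"
proof (cases n)
  case (Suc m)
  then have "\<exists>q. cantor_digits b n = 3 * q \<or> cantor_digits b n = 3 * q + 2"
    by (intro exI[of _ "cantor_digits b m"]) simp
  then show ?thesis by presburger
qed simp

text \<open>Division by 3 undoes one step of the recursion, because the digit added there is 0 or
  2.\<close>

lemma cantor_digits_div: "i \<le> n \<Longrightarrow> cantor_digits b n div 3 ^ i = cantor_digits b (n - i)"
proof (induction i)
  case (Suc i)
  have "cantor_digits b n div 3 ^ Suc i = (cantor_digits b n div 3 ^ i) div 3"
    unfolding power_Suc2 by (rule zdiv_zmult2_eq) simp
  also have "\<dots> = cantor_digits b (Suc (n - Suc i)) div 3"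
    using Suc by (simp add: Suc_diff_Suc)
  also have "\<dots> = cantor_digits b (n - Suc i)"
    by simp
  finally show ?case .
qed simp

lemma cantor_point_exists: "\<exists>x. cantor_point b x"
proof -
  define lo hi :: "nat \<Rightarrow> real"
    where "lo = (\<lambda>n. real_of_int (cantor_digits b n) / 3 ^ n)"
      and "hi = (\<lambda>n. (real_of_int (cantor_digits b n) + 1) / 3 ^ n)"
  have lo: "incseq lo" and hi: "decseq hi"
    by (auto simp: lo_def hi_def field_simps intro!: incseq_SucI decseq_SucI)
  \<comment> \<open>Comparison at the common level \<open>max m n\<close> puts every left end below
    every right end, so the supremum of the left ends lies in all the intervals.\<close>
  have le: "lo m \<le> hi n" for m n
  proof -
    have "lo m \<le> lo (max m n)" "lo (max m n) \<le> hi (max m n)" "hi (max m n) \<le> hi n"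
      using lo hi by (auto simp: incseq_def decseq_def lo_def hi_def divide_right_mono)
    then show ?thesis by linarith
  qed
  define x where "x = (SUP n. lo n)"
  have "lo n \<le> x" for n
    unfolding x_def by (rule cSUP_upper) (use le in \<open>auto intro!: bdd_aboveI[of _ "hi 0"]\<close>)
  moreover have "x \<le> hi n" for n
    unfolding x_def by (rule cSUP_least) (use le in auto)
  ultimately have "cantor_point b x"
    by (auto simp: cantor_point_def lo_def hi_def field_simps)
  then show ?thesis ..
qed

lemma cantor_point_unit: "cantor_point b x \<Longrightarrow> x \<in> {0..1}"
  unfolding cantor_point_def by (drule spec[of _ 0]) simp

text \<open>The ramp has period 2, so the even integer \<^term>\<open>cantor_digits b n\<close> may be subtracted from its
  argument.\<close>

lemma ramp_cantor_point:
  assumes "cantor_point b x"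
  shows "ramp (3 ^ n * x) = of_bool (b n)"
proof -
  obtain m where m: "cantor_digits b n = 2 * m"
    using even_cantor_digits by (metis evenE)
  define y where "y = 3 ^ n * x - real_of_int (cantor_digits b n)"
  have "real_of_int (cantor_digits b (Suc n)) \<le> 3 ^ Suc n * x"
       "3 ^ Suc n * x \<le> real_of_int (cantor_digits b (Suc n)) + 1"
    using assms unfolding cantor_point_def by blast+
  \<comment> \<open>The next digit places \<open>y\<close> in the first or the last third of [0, 1],
    where the cosine is at least 1/2 or at most -1/2.\<close>
  then have y: "2 * of_bool (b n) \<le> 3 * y" "3 * y \<le> 2 * of_bool (b n) + 1"
    by (auto simp: y_def algebra_simps)
  have c: "cos (pi * (3 ^ n * x)) = cos (pi * y)"
  proof -
    have "pi * (3 ^ n * x) = pi * y + 2 * pi * of_int m"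
      by (simp add: y_def m algebra_simps)
    then show ?thesis
      using sin_cos_eq_iff by blast
  qed
  show ?thesis
  proof (cases "b n")
    case True
    then have "2 * pi / 3 \<le> pi * y" "pi * y \<le> pi"
      using y by (auto simp: field_simps)
    then have "cos (pi * y) \<le> cos (2 * pi / 3)"
      using y True by (intro cos_monotone_0_pi_le) auto
    then show ?thesis
      using True c by (simp add: ramp_def cos_120)
  next
    case False
    then have "pi * y \<le> pi / 3" "0 \<le> pi * y"
      using y by (auto simp: field_simps)
    then have "cos (pi / 3) \<le> cos (pi * y)"
      using y False by (intro cos_monotone_0_pi_le) auto
    then show ?thesis
      using False c by (simp add: ramp_def cos_60)
  qed
qed

section \<open>Binary expansions and surjectivity onto the unit square\<close>

lemma binary_expansion:
  assumes "u \<in> {0..1::real}"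
  shows "\<exists>b. (\<lambda>n. of_bool (b n) / 2 ^ Suc n) sums u"
proof -
  \<comment> \<open>Greedy digits: \<open>r n\<close> is the remainder after \<open>n\<close>
    digits, scaled by \<open>2 ^ n\<close>. It stays in [0, 1], also for \<open>u = 1\<close>, where
    all digits are 1.\<close>
  define r where "r = rec_nat u (\<lambda>n s. 2 * s - of_bool (1/2 \<le> s))"
  have r0: "r 0 = u" and rS: "r (Suc n) = 2 * r n - of_bool (1/2 \<le> r n)" for n
    by (simp_all add: r_def)
  have r01: "0 \<le> r n \<and> r n \<le> 1" for n
    using assms by (induction n) (auto simp: r0 rS)
  let ?b = "\<lambda>n. 1/2 \<le> r n"
  have part: "(\<Sum>i<n. of_bool (?b i) / 2 ^ Suc i) = u - r n / 2 ^ n" for n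
    by (induction n) (auto simp: r0 rS field_simps)
  have "(\<lambda>n. r n * (1/2) ^ n) \<longlonglongrightarrow> 0"
  proof (rule tendsto_sandwich[of "\<lambda>_. 0" _ _ "\<lambda>n. (1/2::real) ^ n"])
    show "(\<lambda>n. (1/2::real) ^ n) \<longlonglongrightarrow> 0"
      by (rule LIMSEQ_power_zero) simp
  qed (use r01 in \<open>auto simp: mult_left_le_one_le intro!: always_eventually\<close>)
  then have "(\<lambda>n. u - r n / 2 ^ n) \<longlonglongrightarrow> u - 0"
    by (intro tendsto_intros) (simp add: power_one_over field_simps)
  then have "(\<lambda>n. of_bool (?b n) / 2 ^ Suc n) sums u"
    unfolding sums_def part by simp
  then show ?thesis by (intro exI)
qed

lemma schoenberg_surj:
  assumes "u \<in> {0..1}" "v \<in> {0..1}"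
  shows "\<exists>b x. cantor_point b x \<and> schoenberg 0 x = u \<and> schoenberg 1 x = v"
proof -
  obtain bu bv where bu: "(\<lambda>n. of_bool (bu n) / 2 ^ Suc n) sums u"
    and bv: "(\<lambda>n. of_bool (bv n) / 2 ^ Suc n) sums v"
    using assms binary_expansion by metis
  \<comment> \<open>Interleaving the two expansions lets a single Cantor point encode both
    coordinates.\<close>
  define b where "b n = (if even n then bu (n div 2) else bv (n div 2))" for n
  obtain x where x: "cantor_point b x"
    using cantor_point_exists by blast
  have "b (2 * n + 0) = bu n" "b (2 * n + 1) = bv n" for n
    by (simp_all add: b_def)
  then have "schoenberg 0 x = u" "schoenberg 1 x = v"
    unfolding schoenberg_def ramp_cantor_point[OF x] using bu bv by (simp_all add: sums_iff)
  with x show ?thesis by blast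
qed

section \<open>Bumps in disjoint intervals\<close>

text \<open>The constants make the derivative attain its extreme values \<open>1\<close> and \<open>-1\<close>, at \<open>-1\<close> and \<open>1\<close>.\<close>

definition bump :: "real \<Rightarrow> real" where
  "bump s = (max 0 (3 - s\<^sup>2))\<^sup>2 / 8"

definition bump' :: "real \<Rightarrow> real" where
  "bump' s = - s * max 0 (3 - s\<^sup>2) / 2"

text \<open>Squaring removes the corner of the positive part at 0: the difference quotient there is
  at most |h|. Hence \<open>bump\<close> is continuously differentiable.\<close>

lemma DERIV_positive_part_squared: "((\<lambda>u. (max 0 u)\<^sup>2) has_real_derivative 2 * max 0 u) (at (u::real))"
proof (cases "u = 0")
  case True
  have "(\<lambda>h. (max 0 (0 + h))\<^sup>2 / h :: real) \<midarrow>0\<rightarrow> 0"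
  proof (rule Lim_null_comparison)
    show "\<forall>\<^sub>F h in at 0. norm ((max 0 (0 + h))\<^sup>2 / h :: real) \<le> \<bar>h\<bar>"
      by (intro always_eventually) (auto simp: max_def power2_eq_square)
    show "((\<lambda>h. \<bar>h\<bar>) \<longlongrightarrow> (0::real)) (at 0)"
      by (intro tendsto_eq_intros) auto
  qed
  then show ?thesis
    using True by (simp add: DERIV_def)
next
  case False
  show ?thesis
  proof (cases "u > 0")
    case True
    have "((\<lambda>u. u\<^sup>2) has_real_derivative 2 * max 0 u) (at u)"
      using True by (auto intro!: derivative_eq_intros)
    then show ?thesis
      by (rule has_field_derivative_transform_within_open[of _ _ _ "{0<..}"]) (use True in auto)
  next
    case False
    have "((\<lambda>u. 0) has_real_derivative 2 * max 0 u) (at u)"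
      using False by (auto intro!: derivative_eq_intros)
    then show ?thesis
      by (rule has_field_derivative_transform_within_open[of _ _ _ "{..<0}"])
         (use False \<open>u \<noteq> 0\<close> in auto)
  qed
qed

lemma DERIV_bump: "(bump has_real_derivative bump' s) (at s)"
proof -
  have "((\<lambda>s. 3 - s\<^sup>2) has_real_derivative - 2 * s) (at s)"
    by (auto intro!: derivative_eq_intros)
  from DERIV_cdivide[OF DERIV_chain2[OF DERIV_positive_part_squared this], of 8]
  show ?thesis
    unfolding bump_def bump'_def by (simp add: mult_ac)
qed

lemma isCont_bump': "isCont bump' s"
  unfolding bump'_def by (intro continuous_intros) auto

lemma bump_bounds: "0 \<le> bump s" "bump s \<le> 2"
proof -
  have "(max 0 (3 - s\<^sup>2))\<^sup>2 \<le> 3\<^sup>2"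
    by (intro power_mono) auto
  then show "bump s \<le> 2" by (simp add: bump_def)
qed (simp add: bump_def)

lemma bump_eq_0: "2 \<le> \<bar>s\<bar> \<Longrightarrow> bump s = 0" "2 \<le> \<bar>s\<bar> \<Longrightarrow> bump' s = 0"
proof -
  assume "2 \<le> \<bar>s\<bar>"
  then have "2\<^sup>2 \<le> \<bar>s\<bar>\<^sup>2" by (intro power_mono) auto
  then show "bump s = 0" "bump' s = 0" by (simp_all add: bump_def bump'_def)
qed

lemma bump'_at_1: "bump' 1 = -1" "bump' (-1) = 1"
  by (simp_all add: bump'_def)

lemma abs_bump'_le_1: "\<bar>bump' s\<bar> \<le> 1"
proof (cases "s\<^sup>2 \<le> 3")
  case True
  \<comment> \<open>With a = |s|, the polynomial 2 - a (3 - a^2) has a double root at a = 1, where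
    the extreme slope is attained.\<close>
  have "0 \<le> (\<bar>s\<bar> - 1)\<^sup>2 * (\<bar>s\<bar> + 2)" by simp
  also have "\<dots> = 2 - \<bar>s\<bar> * (3 - \<bar>s\<bar>\<^sup>2)" by (simp add: power2_eq_square algebra_simps)
  finally show ?thesis
    using True by (simp add: bump'_def abs_mult)
qed (simp add: bump'_def)

locale disjoint_balls =
  fixes I :: "'i set" and c w :: "'i \<Rightarrow> real"
  assumes w_pos: "i \<in> I \<Longrightarrow> 0 < w i" and w_le_1: "i \<in> I \<Longrightarrow> w i \<le> 1"
    and disjoint: "i \<in> I \<Longrightarrow> j \<in> I \<Longrightarrow> t \<in> ball (c i) (w i) \<Longrightarrow> t \<in> ball (c j) (w j) \<Longrightarrow> i = j"
begin

text \<open>The delicate points are those outside all balls, where infinitely many balls may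
  accumulate. Bumps of height at most \<open>2 * e * (w i)\<^sup>2\<close>, supported in the inner
  half of their balls, are quadratically small in the distance to such a point, so the sum has
  derivative 0 there.\<close>

lemma bump_sum_exists:
  fixes v \<rho> :: "'i \<Rightarrow> real"
  assumes v_pos: "\<And>i. i \<in> I \<Longrightarrow> 0 < v i"
    and v_small: "\<And>i. i \<in> I \<Longrightarrow> 4 * v i \<le> w i"
    and height: "\<And>i. i \<in> I \<Longrightarrow> \<bar>\<rho> i\<bar> * v i \<le> e * (w i)\<^sup>2" and "0 \<le> e"
  obtains h h' where
    "\<And>t. (h has_real_derivative h' t) (at t)" "\<And>t. \<bar>h t\<bar> \<le> 2 * e"
    "\<And>t i. i \<in> I \<Longrightarrow> t \<in> ball (c i) (w i) \<Longrightarrow> h' t = \<rho> i * bump' ((t - c i) / v i)"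
    "\<And>t. (\<And>i. i \<in> I \<Longrightarrow> t \<notin> ball (c i) (w i)) \<Longrightarrow> h' t = 0"
proof -
  define B where "B i t = \<rho> i * v i * bump ((t - c i) / v i)" for i t
  \<comment> \<open>The index is unique inside \<open>U\<close> by disjointness; outside
    \<open>U\<close> its value is arbitrary, and \<open>h\<close> and \<open>h'\<close> test
    membership in \<open>U\<close> first.\<close>
  define ix where "ix t = (THE i. i \<in> I \<and> t \<in> ball (c i) (w i))" for t
  define U where "U = (\<Union>i\<in>I. ball (c i) (w i))"
  define h where "h t = (if t \<in> U then B (ix t) t else 0)" for t
  define h' where "h' t = (if t \<in> U then \<rho> (ix t) * bump' ((t - c (ix t)) / v (ix t)) else 0)" for t
  have ix: "ix t = i" if "i \<in> I" "t \<in> ball (c i) (w i)" for i t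
    unfolding ix_def using that disjoint by blast
  have h_ball: "h t = B i t" and h'_ball: "h' t = \<rho> i * bump' ((t - c i) / v i)"
    if "i \<in> I" "t \<in> ball (c i) (w i)" for i t
    using that ix[OF that] by (auto simp: h_def h'_def U_def)
  have B_bound: "\<bar>B i t\<bar> \<le> 2 * e * (w i)\<^sup>2" if "i \<in> I" for i t
  proof -
    have "\<bar>B i t\<bar> = (\<bar>\<rho> i\<bar> * v i) * bump ((t - c i) / v i)"
      using v_pos[OF that] bump_bounds by (simp add: B_def abs_mult)
    also have "\<dots> \<le> (e * (w i)\<^sup>2) * 2"
      using bump_bounds \<open>0 \<le> e\<close> by (intro mult_mono[OF height[OF that]]) auto
    finally show ?thesis by (simp add: mult_ac)
  qed
  have B_supp: "B i t = 0" if "i \<in> I" "w i / 2 \<le> \<bar>t - c i\<bar>" for i t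
  proof -
    have "2 * v i \<le> \<bar>t - c i\<bar>" using v_small[OF that(1)] that(2) by linarith
    then have "2 \<le> \<bar>(t - c i) / v i\<bar>" using v_pos[OF that(1)] by (simp add: field_simps)
    then show ?thesis by (simp add: B_def bump_eq_0)
  qed
  have der_out: "(h has_real_derivative 0) (at t)" if t: "t \<notin> U" for t
  proof -
    have quad: "\<bar>h s\<bar> \<le> 8 * e * (s - t)\<^sup>2" for s
    proof (cases "s \<in> U")
      case True
      then obtain i where i: "i \<in> I" "s \<in> ball (c i) (w i)" by (auto simp: U_def)
      show ?thesis
      proof (cases "w i / 2 \<le> \<bar>s - c i\<bar>")
        case True
        then show ?thesis using B_supp[OF i(1)] h_ball[OF i] \<open>0 \<le> e\<close> by simp
      next
        case False
        \<comment> \<open>Since \<open>t\<close> is outside the ball and \<open>s\<close> in its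
          inner half, their distance is at least half the radius; this is the source of the constant
          8.\<close>
        have "w i \<le> \<bar>t - c i\<bar>" using t i(1) by (force simp: U_def dist_real_def)
        moreover have "\<bar>t - c i\<bar> \<le> \<bar>s - c i\<bar> + \<bar>s - t\<bar>" by linarith
        ultimately have "w i \<le> 2 * \<bar>s - t\<bar>" using False by argo
        then have "(w i)\<^sup>2 \<le> (2 * \<bar>s - t\<bar>)\<^sup>2" using w_pos[OF i(1)] by (intro power_mono) auto
        then have "2 * e * (w i)\<^sup>2 \<le> 2 * e * (4 * (s - t)\<^sup>2)"
          using \<open>0 \<le> e\<close> by (intro mult_left_mono) (auto simp: power_mult_distrib)
        then show ?thesis using B_bound[OF i(1), of s] h_ball[OF i] by linarith
      qed
    qed (use \<open>0 \<le> e\<close> in \<open>simp add: h_def\<close>)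
    have "(\<lambda>d. (h (t + d) - h t) / d) \<midarrow>0\<rightarrow> 0"
    proof (rule Lim_null_comparison)
      show "\<forall>\<^sub>F d in at 0. norm ((h (t + d) - h t) / d) \<le> 8 * e * \<bar>d\<bar>"
      proof (intro always_eventually allI)
        fix d
        show "norm ((h (t + d) - h t) / d) \<le> 8 * e * \<bar>d\<bar>"
          using quad[of "t + d"] t
          by (cases "d = 0")
             (auto simp: h_def divide_le_eq power2_eq_square mult.assoc)
      qed
      show "((\<lambda>d. 8 * e * \<bar>d\<bar>) \<longlongrightarrow> 0) (at 0)"
        by (intro tendsto_eq_intros) auto
    qed
    then show ?thesis by (simp add: DERIV_def)
  qed
  have der_in: "(h has_real_derivative h' t) (at t)" if i: "i \<in> I" "t \<in> ball (c i) (w i)" for t i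
  proof -
    have lin: "((\<lambda>t. (t - c i) / v i) has_real_derivative 1 / v i) (at t)"
      using v_pos[OF i(1)] by (auto intro!: derivative_eq_intros)
    have "(B i has_real_derivative (\<rho> i * v i) * (bump' ((t - c i) / v i) * (1 / v i))) (at t)"
      unfolding B_def by (intro DERIV_cmult DERIV_chain2[OF DERIV_bump lin])
    then have "(B i has_real_derivative h' t) (at t)"
      using v_pos[OF i(1)] by (simp add: h'_ball[OF i])
    then show ?thesis
      by (rule has_field_derivative_transform_within_open[of _ _ _ "ball (c i) (w i)"])
         (use i h_ball in auto)
  qed
  show ?thesis
  proof
    fix t
    show "(h has_real_derivative h' t) (at t)"
    proof (cases "t \<in> U")
      case True
      then show ?thesis using der_in by (auto simp: U_def)
    next
      case False
      then show ?thesis using der_out by (simp add: h'_def)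
    qed
    show "\<bar>h t\<bar> \<le> 2 * e"
    proof (cases "t \<in> U")
      case True
      then obtain i where i: "i \<in> I" "t \<in> ball (c i) (w i)" by (auto simp: U_def)
      have "(w i)\<^sup>2 \<le> 1" using w_pos[OF i(1)] w_le_1[OF i(1)] by (simp add: power_le_one)
      then have "2 * e * (w i)\<^sup>2 \<le> 2 * e" using \<open>0 \<le> e\<close> by (simp add: mult_left_le)
      then show ?thesis using B_bound[OF i(1), of t] h_ball[OF i] by simp
    qed (use \<open>0 \<le> e\<close> in \<open>simp add: h_def\<close>)
    show "h' t = 0" if "\<And>i. i \<in> I \<Longrightarrow> t \<notin> ball (c i) (w i)"
      using that by (auto simp: h'_def U_def)
  qed (rule h'_ball)
qed

text \<open>A narrow bump of slope slightly below \<open>r (c i)\<close> stays under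
  \<open>r\<close> by continuity. Its slope attains both extremes inside the open ball, where
  \<open>h'\<close> is given by one continuous formula.\<close>

lemma oscillation_exists:
  fixes r :: "real \<Rightarrow> real"
  assumes cont: "continuous_on UNIV r" and r_bound: "\<And>t. 0 \<le> r t \<and> r t \<le> R" and "0 < \<epsilon>"
  obtains h h' where
    "\<And>t. (h has_real_derivative h' t) (at t)" "\<And>t. \<bar>h t\<bar> \<le> \<epsilon>" "\<And>t. \<bar>h' t\<bar> \<le> r t"
    "\<And>i \<sigma>. i \<in> I \<Longrightarrow> \<sigma> \<in> {-1, 1} \<Longrightarrow>
       \<exists>t\<in>ball (c i) (w i). isCont h' t \<and> r (c i) - w i \<le> \<sigma> * h' t"
proof -
  \<comment> \<open>Lowering the slope by \<open>w i\<close> leaves room for the variation of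
    \<open>r\<close>, and costs nothing in the limit of shrinking balls.\<close>
  define \<rho> where "\<rho> i = max 0 (r (c i) - w i)" for i
  define e where "e = \<epsilon> / 2"
  have "0 \<le> R" using r_bound[of 0] by linarith
  have "\<exists>v>0. 4 * v \<le> w i \<and> R * v \<le> e * (w i)\<^sup>2 \<and> (\<forall>t. \<bar>t - c i\<bar> \<le> 2 * v \<longrightarrow> \<rho> i \<le> r t)"
    if i: "i \<in> I" for i
  proof -
    have "isCont r (c i)" using cont by (simp add: continuous_on_eq_continuous_at)
    then obtain d where d: "d > 0" "\<And>t. \<bar>t - c i\<bar> < d \<Longrightarrow> \<bar>r t - r (c i)\<bar> < w i"
      unfolding continuous_at_eps_delta dist_real_def using w_pos[OF i] by blast
    \<comment> \<open>The three bounds keep the bump in the inner half of its ball, make its height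
      quadratic in \<open>w i\<close>, and confine its support to where \<open>r\<close> varies by
      less than \<open>w i\<close>. The denominator \<open>R + 1\<close> is positive even for
      \<open>R = 0\<close>.\<close>
    define v where "v = Min {w i / 4, e * (w i)\<^sup>2 / (R + 1), d / 3}"
    have v: "v \<le> w i / 4" "v \<le> e * (w i)\<^sup>2 / (R + 1)" "v \<le> d / 3"
      unfolding v_def by (intro Min_le; simp)+
    have "v > 0"
      using w_pos[OF i] d(1) \<open>0 < \<epsilon>\<close> \<open>0 \<le> R\<close> by (auto simp: v_def e_def)
    moreover have "R * v \<le> e * (w i)\<^sup>2"
      using v(2) \<open>0 \<le> R\<close> \<open>v > 0\<close> by (simp add: field_simps)
    moreover have "\<rho> i \<le> r t" if "\<bar>t - c i\<bar> \<le> 2 * v" for t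
      using d(2)[of t] that v(3) d(1) r_bound[of t] by (auto simp: \<rho>_def)
    ultimately show ?thesis using v(1) by (intro exI[of _ v]) auto
  qed
  then obtain v where v: "\<And>i. i \<in> I \<Longrightarrow> 0 < v i" "\<And>i. i \<in> I \<Longrightarrow> 4 * v i \<le> w i"
    "\<And>i. i \<in> I \<Longrightarrow> R * v i \<le> e * (w i)\<^sup>2"
    "\<And>i t. i \<in> I \<Longrightarrow> \<bar>t - c i\<bar> \<le> 2 * v i \<Longrightarrow> \<rho> i \<le> r t"
    by metis
  have \<rho>0: "0 \<le> \<rho> i" for i by (simp add: \<rho>_def)
  have height: "\<bar>\<rho> i\<bar> * v i \<le> e * (w i)\<^sup>2" if "i \<in> I" for i
  proof -
    have "\<bar>\<rho> i\<bar> \<le> R" using r_bound[of "c i"] w_pos[OF that] \<open>0 \<le> R\<close> by (auto simp: \<rho>_def)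
    then have "\<bar>\<rho> i\<bar> * v i \<le> R * v i" using v(1)[OF that] by (intro mult_right_mono) auto
    then show ?thesis using v(3)[OF that] by linarith
  qed
  have "0 \<le> e" using \<open>0 < \<epsilon>\<close> by (simp add: e_def)
  obtain h h' where h: "\<And>t. (h has_real_derivative h' t) (at t)" "\<And>t. \<bar>h t\<bar> \<le> 2 * e"
    and h'_ball: "\<And>t i. i \<in> I \<Longrightarrow> t \<in> ball (c i) (w i) \<Longrightarrow> h' t = \<rho> i * bump' ((t - c i) / v i)"
    and h'_out: "\<And>t. (\<And>i. i \<in> I \<Longrightarrow> t \<notin> ball (c i) (w i)) \<Longrightarrow> h' t = 0"
    using bump_sum_exists[OF v(1,2) height \<open>0 \<le> e\<close>] by metis
  show ?thesis
  proof
    fix t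
    show "(h has_real_derivative h' t) (at t)" by (rule h)
    show "\<bar>h t\<bar> \<le> \<epsilon>" using h(2)[of t] by (simp add: e_def)
    show "\<bar>h' t\<bar> \<le> r t"
    proof (cases "\<exists>i\<in>I. t \<in> ball (c i) (w i)")
      case True
      then obtain i where i: "i \<in> I" "t \<in> ball (c i) (w i)" by blast
      show ?thesis
      proof (cases "\<bar>t - c i\<bar> \<le> 2 * v i")
        case True
        have "\<bar>h' t\<bar> \<le> \<rho> i * 1"
          unfolding h'_ball[OF i] abs_mult using \<rho>0[of i] abs_bump'_le_1
          by (intro mult_mono) auto
        then show ?thesis using v(4)[OF i(1) True] by simp
      next
        case False
        then have "2 \<le> \<bar>(t - c i) / v i\<bar>" using v(1)[OF i(1)] by (simp add: field_simps)
        then show ?thesis using h'_ball[OF i] r_bound[of t] by (simp add: bump_eq_0)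
      qed
    next
      case False
      then show ?thesis using h'_out[of t] r_bound[of t] by auto
    qed
  next
    fix i \<sigma> assume i: "i \<in> I" and \<sigma>: "\<sigma> \<in> {-1, 1::real}"
    \<comment> \<open>The minus sign is due to \<open>bump'\<close> being 1 at -1 and -1 at
      1.\<close>
    define t where "t = c i - \<sigma> * v i"
    have vi: "0 < v i" "4 * v i \<le> w i" using v i by auto
    have t: "t \<in> ball (c i) (w i)"
      using \<sigma> vi by (auto simp: t_def dist_real_def)
    have "\<sigma> * h' t = \<rho> i"
      using \<sigma> vi unfolding h'_ball[OF i t] by (auto simp: t_def bump'_at_1)
    moreover have "isCont h' t"
    proof -
      have "isCont (\<lambda>t. \<rho> i * bump' ((t - c i) / v i)) t"
        by (intro continuous_intros isCont_o2[OF _ isCont_bump']) (use vi in auto)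
      moreover have "\<forall>\<^sub>F s in nhds t. h' s = \<rho> i * bump' ((s - c i) / v i)"
        using eventually_nhds_in_open[OF open_ball t] by eventually_elim (rule h'_ball[OF i])
      ultimately show ?thesis by (subst isCont_cong)
    qed
    ultimately show "\<exists>t\<in>ball (c i) (w i). isCont h' t \<and> r (c i) - w i \<le> \<sigma> * h' t"
      using t by (intro bexI[of _ t]) (auto simp: \<rho>_def)
  qed
qed

end

section \<open>The gaps of the Cantor set\<close>

text \<open>The pair \<open>(n, k)\<close> stands for the interval \<open>(k / 3\<^sup>n, (k + 1) / 3\<^sup>n)\<close>. The congruences say that
  \<open>n\<close> is the first position at which the ternary expansion of its points has the digit 1 (position 0 being the
  last digit of the integer part).\<close>

definition ternary_gaps :: "(nat \<times> int) set" where
  "ternary_gaps = {(n, k). k mod 3 = 1 \<and> (\<forall>i\<in>{1..n}. (k div 3 ^ i) mod 3 \<noteq> 1)}"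

definition gap_center :: "nat \<times> int \<Rightarrow> real" where
  "gap_center = (\<lambda>(n, k). (real_of_int k + 1/2) / 3 ^ n)"

definition gap_radius :: "nat \<times> int \<Rightarrow> real" where
  "gap_radius = (\<lambda>(n, k). 1 / (2 * 3 ^ n))"

lemma gap_ball_floor:
  assumes "t \<in> ball (gap_center (n, k)) (gap_radius (n, k))"
  shows "\<lfloor>3 ^ n * t\<rfloor> = k"
proof -
  have "\<bar>real_of_int k + 1/2 - 3 ^ n * t\<bar> = \<bar>3 ^ n * (gap_center (n, k) - t)\<bar>"
    by (simp add: gap_center_def right_diff_distrib)
  also have "\<dots> = 3 ^ n * \<bar>gap_center (n, k) - t\<bar>"
    by (simp add: abs_mult)
  also have "\<dots> < 3 ^ n * gap_radius (n, k)"
    using assms by (intro mult_strict_left_mono) (auto simp: dist_real_def)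
  also have "\<dots> = 1/2"
    by (simp add: gap_radius_def)
  finally have "\<bar>real_of_int k + 1/2 - 3 ^ n * t\<bar> < 1/2" .
  then show ?thesis unfolding floor_eq_iff abs_less_iff by linarith
qed

lemma floor_coarser_digit:
  assumes "n < n'"
  shows "\<lfloor>3 ^ n * t\<rfloor> = \<lfloor>3 ^ n' * t :: real\<rfloor> div 3 ^ (n' - n)"
proof -
  have "3 ^ n * t = (3 ^ n' * t) / real_of_int (3 ^ (n' - n))"
    using assms by (simp add: field_simps flip: power_add)
  then show ?thesis
    by (metis floor_divide_real_eq_div zero_le_numeral zero_le_power)
qed

interpretation ternary: disjoint_balls ternary_gaps gap_center gap_radius
proof
  fix i assume "i \<in> ternary_gaps"
  have "(1::real) \<le> 2 * 3 ^ n" for n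
    using one_le_power[of "3::real" n] by linarith
  then show "gap_radius i \<le> 1"
    by (cases i) (simp add: gap_radius_def)
next
  fix i j t
  assume *: "i \<in> ternary_gaps" "j \<in> ternary_gaps" "t \<in> ball (gap_center i) (gap_radius i)"
    "t \<in> ball (gap_center j) (gap_radius j)"
  \<comment> \<open>At different levels, \<open>k\<close> is a prefix of \<open>k'\<close>. Its last
    digit 1 contradicts the requirement that no earlier digit of \<open>k'\<close> be 1.\<close>
  have no: False if "n < n'" "(n, k) \<in> ternary_gaps" "(n', k') \<in> ternary_gaps"
    "\<lfloor>3 ^ n * t\<rfloor> = k" "\<lfloor>3 ^ n' * t\<rfloor> = k'" for n n' k k'
    using that floor_coarser_digit[OF that(1), of t] by (auto simp: ternary_gaps_def)
  show "i = j"
    using * no gap_ball_floor by (cases i; cases j) (metis linorder_neqE_nat)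
qed (auto simp: gap_radius_def)

text \<open>The open middle third of the level \<open>n\<close> interval containing \<open>x\<close>
  is a gap: appending the digit 1 gives \<open>k = 3 * cantor_digits b n + 1\<close>, whose earlier
  digits are 0 or 2. The length of that interval bounds both the size of the gap and its distance
  from \<open>x\<close>.\<close>

lemma gaps_accumulate_at_cantor_point:
  assumes "cantor_point b x" "0 < \<delta>"
  obtains i where "i \<in> ternary_gaps" "gap_radius i < \<delta>" "\<bar>gap_center i - x\<bar> < \<delta>"
proof -
  obtain n where n: "(1/3) ^ n < \<delta>"
    using real_arch_pow_inv[OF \<open>0 < \<delta>\<close>, of "1/3"] by auto
  define k where "k = 3 * cantor_digits b n + 1"
  have "(k div 3 ^ i) mod 3 \<noteq> 1" if "i \<in> {1..Suc n}" for i
  proof -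
    obtain j where j: "i = Suc j" "j \<le> n" using \<open>i \<in> {1..Suc n}\<close> by (cases i) auto
    have "k div 3 ^ i = (k div 3) div 3 ^ j"
      unfolding j power_Suc by (rule zdiv_zmult2_eq) simp
    also have "\<dots> = cantor_digits b (n - j)"
      using cantor_digits_div[OF j(2)] by (simp add: k_def)
    finally show ?thesis using cantor_digits_mod_3 by metis
  qed
  then have "(Suc n, k) \<in> ternary_gaps"
    by (auto simp: ternary_gaps_def k_def)
  moreover have "gap_radius (Suc n, k) < \<delta>"
  proof -
    have "gap_radius (Suc n, k) \<le> (1/3) ^ n" by (simp add: gap_radius_def power_one_over field_simps)
    with n show ?thesis by linarith
  qed
  moreover have "\<bar>gap_center (Suc n, k) - x\<bar> < \<delta>"
  proof -
    have "real_of_int (cantor_digits b n) \<le> 3 ^ n * x" "3 ^ n * x \<le> real_of_int (cantor_digits b n) + 1"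
      using assms(1) by (auto simp: cantor_point_def)
    moreover have "3 ^ n * (gap_center (Suc n, k) - x) = real_of_int (cantor_digits b n) + 1/2 - 3 ^ n * x"
      by (simp add: gap_center_def k_def right_diff_distrib)
    ultimately have "\<bar>3 ^ n * (gap_center (Suc n, k) - x)\<bar> \<le> 1"
      unfolding abs_le_iff by linarith
    then have "\<bar>gap_center (Suc n, k) - x\<bar> \<le> (1/3) ^ n"
      unfolding abs_mult by (simp add: power_one_over field_simps)
    with n show ?thesis by linarith
  qed
  ultimately show ?thesis by (rule that)
qed

section \<open>Lipschitz functions and antiderivatives on the line\<close>

text \<open>McShane's infimum formula. Averaging needs values on the whole line, beyond the ends of
  \<open>J\<close>.\<close>

lemma real_lipschitz_extension:
  fixes f :: "real \<Rightarrow> real"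
  assumes "J \<noteq> {}" "0 \<le> k" and lip: "\<And>x y. x \<in> J \<Longrightarrow> y \<in> J \<Longrightarrow> \<bar>f x - f y\<bar> \<le> k * \<bar>x - y\<bar>"
  obtains F where "\<And>x. x \<in> J \<Longrightarrow> F x = f x" "\<And>s t. \<bar>F s - F t\<bar> \<le> k * \<bar>s - t\<bar>"
proof -
  define F where "F t = (INF y\<in>J. f y + k * \<bar>t - y\<bar>)" for t
  have tri: "k * \<bar>s - y\<bar> \<le> k * \<bar>t - y\<bar> + k * \<bar>s - t\<bar>" for s t y
    unfolding distrib_left[symmetric] by (rule mult_left_mono) (use \<open>0 \<le> k\<close> in auto)
  obtain y0 where y0: "y0 \<in> J" using \<open>J \<noteq> {}\<close> by blast
  have bdd: "bdd_below ((\<lambda>y. f y + k * \<bar>t - y\<bar>) ` J)" for t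
  proof (rule bdd_belowI2)
    fix y assume "y \<in> J"
    then have "f y0 - f y \<le> k * \<bar>y0 - y\<bar>" using lip[OF y0] abs_le_D1 by blast
    then show "f y0 - k * \<bar>y0 - t\<bar> \<le> f y + k * \<bar>t - y\<bar>" using tri[of y0 y t] by linarith
  qed
  show ?thesis
  proof
    fix x assume x: "x \<in> J"
    show "F x = f x"
    proof (rule antisym)
      show "F x \<le> f x" unfolding F_def using cINF_lower[OF bdd[of x] x] by simp
      show "f x \<le> F x" unfolding F_def
      proof (rule cINF_greatest[OF \<open>J \<noteq> {}\<close>])
        fix y assume "y \<in> J"
        then show "f x \<le> f y + k * \<bar>x - y\<bar>" using lip[OF x] abs_le_D1 by fastforce
      qed
    qed
  next
    have le: "F s \<le> F t + k * \<bar>s - t\<bar>" for s t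
    proof -
      have "F s - k * \<bar>s - t\<bar> \<le> F t"
        unfolding F_def[of t]
      proof (rule cINF_greatest[OF \<open>J \<noteq> {}\<close>])
        fix y assume "y \<in> J"
        then have "F s \<le> f y + k * \<bar>s - y\<bar>" unfolding F_def by (intro cINF_lower[OF bdd])
        then show "F s - k * \<bar>s - t\<bar> \<le> f y + k * \<bar>t - y\<bar>" using tri[of s y t] by linarith
      qed
      then show ?thesis by linarith
    qed
    show "\<bar>F s - F t\<bar> \<le> k * \<bar>s - t\<bar>" for s t
      using le[of s t] le[of t s] by (simp add: abs_le_iff abs_minus_commute)
  qed
qed

lemma real_antiderivative:
  fixes g :: "real \<Rightarrow> real"
  assumes "continuous_on UNIV g"
  obtains G where "\<And>x. (G has_real_derivative g x) (at x)"
  using einterval_antiderivative[of "-\<infinity>" "\<infinity>" g] assms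
  by (auto simp: continuous_on_eq_continuous_at has_real_derivative_iff_has_vector_derivative)

text \<open>\<open>G x\<close> is the mean of \<open>F\<close> over [x, x + d]. Its derivative is a
  difference quotient of \<open>F\<close>, hence continuous and bounded by \<open>k\<close>; by the
  mean value theorem \<open>G x\<close> is a value of \<open>F\<close> in that window.\<close>

lemma real_lipschitz_smoothing:
  fixes F :: "real \<Rightarrow> real"
  assumes "0 \<le> k" and lip: "\<And>s t. \<bar>F s - F t\<bar> \<le> k * \<bar>s - t\<bar>" and "0 < \<epsilon>"
  obtains G g where "\<And>x. (G has_real_derivative g x) (at x)" "continuous_on UNIV g"
    "\<And>x. \<bar>g x\<bar> \<le> k" "\<And>x. \<bar>G x - F x\<bar> \<le> \<epsilon>"
proof -
  have "k-lipschitz_on UNIV F" using assms by (intro lipschitz_onI) (auto simp: dist_real_def)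
  then have cont: "continuous_on UNIV F" by (rule lipschitz_on_continuous_on)
  then obtain H where H: "\<And>x. (H has_real_derivative F x) (at x)" using real_antiderivative by blast
  define d where "d = \<epsilon> / (k + 1)"
  have "0 < d" "k * d \<le> \<epsilon>" using assms by (auto simp: d_def field_simps)
  define G where "G x = (H (x + d) - H x) / d" for x
  define g where "g x = (F (x + d) - F x) / d" for x
  show ?thesis
  proof
    fix x
    show "(G has_real_derivative g x) (at x)"
      unfolding G_def g_def
      using H[of "x + d"] by (intro DERIV_cdivide DERIV_diff H) (simp add: DERIV_shift)
    show "\<bar>g x\<bar> \<le> k"
      using lip[of "x + d" x] \<open>0 < d\<close> by (simp add: g_def field_simps)
    obtain z where z: "x < z" "z < x + d" "H (x + d) - H x = (x + d - x) * F z"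
      using MVT2[of x "x + d" H F] H \<open>0 < d\<close> by auto
    then have "G x = F z" using \<open>0 < d\<close> by (simp add: G_def)
    moreover have "k * \<bar>z - x\<bar> \<le> k * d" using z \<open>0 \<le> k\<close> by (intro mult_left_mono) auto
    ultimately show "\<bar>G x - F x\<bar> \<le> \<epsilon>" using lip[of z x] \<open>k * d \<le> \<epsilon>\<close> by linarith
  next
    show "continuous_on UNIV g"
      unfolding g_def using \<open>0 < d\<close>
      by (intro continuous_intros continuous_on_compose2[OF cont]) auto
  qed
qed

text \<open>Normalised to agree with \<open>G\<close> at \<open>p\<close>, the new antiderivative
  differs from it by a constant on either side of [p, q]. The error is thus uniform on the whole
  line, however long \<open>J\<close> is.\<close>

lemma antiderivative_local_perturbation:
  fixes G g m :: "real \<Rightarrow> real"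
  assumes G: "\<And>x. (G has_real_derivative g x) (at x)" and "continuous_on UNIV m"
    and near: "\<And>x. \<bar>m x - g x\<bar> \<le> B" and same: "\<And>x. x \<notin> {p..q} \<Longrightarrow> m x = g x" and "p \<le> q"
  obtains M where "\<And>x. (M has_real_derivative m x) (at x)" "\<And>x. \<bar>M x - G x\<bar> \<le> B * (q - p)"
proof -
  obtain M0 where M0: "\<And>x. (M0 has_real_derivative m x) (at x)"
    using real_antiderivative[OF \<open>continuous_on UNIV m\<close>] by blast
  define M where "M x = M0 x + (G p - M0 p)" for x
  define D where "D x = M x - G x" for x
  have "0 \<le> B" using near[of p] by linarith
  have M: "(M has_real_derivative m x) (at x)" for x
    unfolding M_def using DERIV_add[OF M0[of x] DERIV_const[of "G p - M0 p"]] by simp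
  have D: "(D has_real_derivative m x - g x) (at x)" for x
    unfolding D_def by (intro DERIV_diff M G)
  have inner: "\<bar>D x\<bar> \<le> B * (q - p)" if x: "x \<in> {p..q}" for x
  proof -
    have "norm (D x - D p) \<le> B * norm (x - p)"
      using near D by (intro field_differentiable_bound[of UNIV D "\<lambda>x. m x - g x"]) auto
    also have "\<dots> \<le> B * (q - p)" using x \<open>0 \<le> B\<close> by (intro mult_left_mono) auto
    finally show ?thesis by (simp add: D_def M_def)
  qed
  have const: "D x = D y" if xy: "x < y" "\<And>z. x < z \<Longrightarrow> z < y \<Longrightarrow> z \<notin> {p..q}" for x y
  proof -
    obtain z where "x < z" "z < y" "D y - D x = (y - x) * (m z - g z)"
      using MVT2[OF xy(1), of D "\<lambda>z. m z - g z"] D by blast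
    then show ?thesis using same[OF xy(2)] by simp
  qed
  show ?thesis
  proof
    show "\<bar>M x - G x\<bar> \<le> B * (q - p)" for x
      unfolding D_def[symmetric]
      using inner[of p] inner[of q] inner[of x] const[of x p] const[of q x] \<open>p \<le> q\<close>
      by (cases "x < p"; cases "q < x") auto
  qed (rule M)
qed

section \<open>Clarke subdifferentials\<close>

lemma open_nonempty_minus_null:
  fixes S N :: "real set"
  assumes "open S" "S \<noteq> {}" "N \<in> null_sets lebesgue"
  shows "S - N \<noteq> {}"
proof
  assume "S - N = {}"
  then have "negligible S"
    using assms(3) negligible_subset[of N S] by (auto simp: negligible_iff_null_sets)
  then show False using open_not_negligible assms by blast
qed

text \<open>Continuity of \<open>lo\<close> and \<open>hi\<close> confines all limits to the
  interval, so it suffices that both ends are limits. The points with extreme slopes could lie in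
  \<open>N\<close>; continuity of \<open>f'\<close> at them allows a shift off \<open>N\<close> with
  little change of slope.\<close>

lemma clarke_subdifferential_eq_interval:
  fixes f f' lo hi :: "real \<Rightarrow> real"
  assumes "open J" "x \<in> J" and N: "N \<in> null_sets lebesgue"
    and der: "\<And>t. t \<in> J \<Longrightarrow> (f has_real_derivative f' t) (at t)"
    and bounds: "\<And>t. t \<in> J \<Longrightarrow> lo t \<le> f' t \<and> f' t \<le> hi t"
    and "isCont lo x" "isCont hi x"
    and near_hi: "\<And>\<delta>. 0 < \<delta> \<Longrightarrow> \<exists>t. \<bar>t - x\<bar> < \<delta> \<and> isCont f' t \<and> hi x - \<delta> \<le> f' t"
    and near_lo: "\<And>\<delta>. 0 < \<delta> \<Longrightarrow> \<exists>t. \<bar>t - x\<bar> < \<delta> \<and> isCont f' t \<and> f' t \<le> lo x + \<delta>"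
  shows "clarke_subdifferential N J f x = {lo x..hi x}"
proof -
  define S where "S = {l. \<exists>X :: nat \<Rightarrow> real. X \<longlonglongrightarrow> x \<and> (\<forall>n. X n \<in> diff_points J f - N) \<and>
                       (\<lambda>n. deriv f (X n)) \<longlonglongrightarrow> l}"
  have dp: "diff_points J f = J"
    using der by (auto simp: diff_points_def real_differentiable_def)
  have deriv: "deriv f t = f' t" if "t \<in> J" for t
    using der[OF that] by (rule DERIV_imp_deriv)
  obtain d0 where d0: "d0 > 0" "ball x d0 \<subseteq> J"
    using assms(1,2) openE by blast
  have inS: "l \<in> S"
    if l: "\<And>\<delta>. 0 < \<delta> \<Longrightarrow> \<exists>t. \<bar>t - x\<bar> < \<delta> \<and> isCont f' t \<and> \<bar>f' t - l\<bar> < \<delta>" for l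
  proof -
    have "\<exists>s. s \<in> J - N \<and> \<bar>s - x\<bar> < 1 / real (Suc n) \<and> \<bar>f' s - l\<bar> < 1 / real (Suc n)" for n
    proof -
      \<comment> \<open>The bound \<open>d0\<close> keeps the shifted point inside
        \<open>J\<close>.\<close>
      define \<delta> where "\<delta> = min d0 (1 / real (Suc n))"
      have "\<delta> > 0" using d0 by (simp add: \<delta>_def)
      then obtain t where t: "\<bar>t - x\<bar> < \<delta>" "isCont f' t" "\<bar>f' t - l\<bar> < \<delta>" using l by blast
      have "\<forall>\<^sub>F s in nhds t. f' s \<in> ball l \<delta>"
        using t(2,3) by (intro topological_tendstoD[OF isCont_tendsto_compose[of t f', OF _ filterlim_ident]])
          (auto simp: dist_real_def abs_minus_commute isCont_def tendsto_at_iff_tendsto_nhds)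
      moreover have "\<forall>\<^sub>F s in nhds t. s \<in> ball x \<delta>"
        using t(1) by (intro eventually_nhds_in_open) (auto simp: dist_real_def abs_minus_commute)
      ultimately have "\<forall>\<^sub>F s in nhds t. f' s \<in> ball l \<delta> \<and> s \<in> ball x \<delta>"
        by (rule eventually_conj)
      then obtain W where W: "open W" "t \<in> W" "\<And>s. s \<in> W \<Longrightarrow> f' s \<in> ball l \<delta> \<and> s \<in> ball x \<delta>"
        unfolding eventually_nhds by blast
      then obtain s where s: "s \<in> W" "s \<notin> N" using open_nonempty_minus_null[OF W(1) _ N] by blast
      then have "\<bar>f' s - l\<bar> < \<delta>" "\<bar>s - x\<bar> < \<delta>"
        using W(3)[OF s(1)] by (auto simp: dist_real_def)
      moreover have "s \<in> J"
        using d0(2) \<open>\<bar>s - x\<bar> < \<delta>\<close> by (auto simp: \<delta>_def dist_real_def abs_minus_commute)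
      ultimately show ?thesis using s(2) by (intro exI[of _ s]) (auto simp: \<delta>_def)
    qed
    then obtain X where X: "\<And>n. X n \<in> J - N" "\<And>n. \<bar>X n - x\<bar> < 1 / real (Suc n)"
      "\<And>n. \<bar>f' (X n) - l\<bar> < 1 / real (Suc n)" by metis
    have inv: "(\<lambda>n. 1 / real (Suc n)) \<longlonglongrightarrow> 0"
      using LIMSEQ_inverse_real_of_nat by (simp add: inverse_eq_divide)
    have "(\<lambda>n. X n - x) \<longlonglongrightarrow> 0"
      by (rule Lim_null_comparison[OF _ inv]) (use X(2) in \<open>auto simp: less_imp_le\<close>)
    moreover have "(\<lambda>n. f' (X n) - l) \<longlonglongrightarrow> 0"
      by (rule Lim_null_comparison[OF _ inv]) (use X(3) in \<open>auto simp: less_imp_le\<close>)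
    ultimately have "X \<longlonglongrightarrow> x" "(\<lambda>n. deriv f (X n)) \<longlonglongrightarrow> l"
      using X(1) deriv by (auto simp: LIM_zero_iff)
    then show "l \<in> S" using X(1) dp by (auto simp: S_def)
  qed
  have near: "\<exists>d>0. d \<le> \<delta> \<and> (\<forall>t. \<bar>t - x\<bar> < d \<longrightarrow> lo x - \<delta> < f' t \<and> f' t < hi x + \<delta>)" if \<delta>: "0 < \<delta>" for \<delta>
  proof -
    obtain d1 where d1: "d1 > 0" "\<And>t. \<bar>t - x\<bar> < d1 \<Longrightarrow> \<bar>lo t - lo x\<bar> < \<delta>"
      using \<open>isCont lo x\<close> \<delta> unfolding continuous_at_eps_delta dist_real_def by blast
    obtain d2 where d2: "d2 > 0" "\<And>t. \<bar>t - x\<bar> < d2 \<Longrightarrow> \<bar>hi t - hi x\<bar> < \<delta>"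
      using \<open>isCont hi x\<close> \<delta> unfolding continuous_at_eps_delta dist_real_def by blast
    have "lo x - \<delta> < f' t \<and> f' t < hi x + \<delta>" if "\<bar>t - x\<bar> < Min {\<delta>, d0, d1, d2}" for t
    proof -
      have "t \<in> J" using that d0(2) by (auto simp: dist_real_def abs_minus_commute)
      then show ?thesis using bounds[of t] d1(2)[of t] d2(2)[of t] that by auto
    qed
    then show ?thesis
      using \<open>0 < \<delta>\<close> d0(1) d1(1) d2(1) by (intro exI[of _ "Min {\<delta>, d0, d1, d2}"]) auto
  qed
  have "hi x \<in> S"
  proof (rule inS)
    fix \<delta> :: real assume "0 < \<delta>"
    then obtain d where d: "0 < d" "d \<le> \<delta>" "\<And>t. \<bar>t - x\<bar> < d \<Longrightarrow> f' t < hi x + \<delta>"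
      using near[of \<delta>] by blast
    \<comment> \<open>Halving \<open>d\<close> turns the weak lower bound of \<open>near_hi\<close>
      into a strict one.\<close>
    then show "\<exists>t. \<bar>t - x\<bar> < \<delta> \<and> isCont f' t \<and> \<bar>f' t - hi x\<bar> < \<delta>"
      using near_hi[of "d / 2"] d(3) by (smt (verit) field_sum_of_halves)
  qed
  moreover have "lo x \<in> S"
  proof (rule inS)
    fix \<delta> :: real assume "0 < \<delta>"
    then obtain d where d: "0 < d" "d \<le> \<delta>" "\<And>t. \<bar>t - x\<bar> < d \<Longrightarrow> lo x - \<delta> < f' t"
      using near[of \<delta>] by blast
    then show "\<exists>t. \<bar>t - x\<bar> < \<delta> \<and> isCont f' t \<and> \<bar>f' t - lo x\<bar> < \<delta>"
      using near_lo[of "d / 2"] d(3) by (smt (verit) field_sum_of_halves)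
  qed
  moreover have "S \<subseteq> {lo x..hi x}"
  proof
    fix l assume "l \<in> S"
    then obtain X where X: "X \<longlonglongrightarrow> x" "\<And>n. X n \<in> J" and lim: "(\<lambda>n. f' (X n)) \<longlonglongrightarrow> l"
      unfolding S_def dp using deriv by auto
    have "lo x \<le> l"
      by (rule LIMSEQ_le[OF isCont_tendsto_compose[OF \<open>isCont lo x\<close> X(1)] lim]) (use X bounds in auto)
    moreover have "l \<le> hi x"
      by (rule LIMSEQ_le[OF lim isCont_tendsto_compose[OF \<open>isCont hi x\<close> X(1)]]) (use X bounds in auto)
    ultimately show "l \<in> {lo x..hi x}" by simp
  qed
  ultimately have "convex hull S = {lo x..hi x}"
  proof (intro antisym)
    assume hl: "hi x \<in> S" "lo x \<in> S" and sub: "S \<subseteq> {lo x..hi x}"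
    show "convex hull S \<subseteq> {lo x..hi x}" using sub by (intro hull_minimal) auto
    have "closed_segment (lo x) (hi x) \<subseteq> convex hull S"
      unfolding segment_convex_hull using hl by (intro hull_mono) auto
    moreover have "lo x \<le> hi x" using hl sub by auto
    ultimately show "{lo x..hi x} \<subseteq> convex hull S" by (simp add: closed_segment_eq_real_ivl)
  qed
  then show ?thesis by (simp add: clarke_subdifferential_def S_def)
qed

text \<open>Derivatives at points of the open set \<open>J\<close> do not see values outside it.
  This carries the result over to the restriction to \<open>J\<close>.\<close>

lemma clarke_subdifferential_cong:
  assumes "open J" and eq: "\<And>t. t \<in> J \<Longrightarrow> f t = g t"
  shows "clarke_subdifferential N J f x = clarke_subdifferential N J g x"
proof -
  have D: "(f has_real_derivative D) (at t) \<longleftrightarrow> (g has_real_derivative D) (at t)" if "t \<in> J" for D t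
    using has_field_derivative_transform_within_open[OF _ \<open>open J\<close> that] eq by metis
  then have deriv: "deriv f t = deriv g t" if "t \<in> J" for t
    using that by (simp add: deriv_def)
  have dp: "diff_points J f = diff_points J g" "diff_points J g \<subseteq> J"
    using D by (auto simp: diff_points_def real_differentiable_def)
  have "(\<lambda>n. deriv f (X n)) = (\<lambda>n. deriv g (X n))"
    if "\<forall>n. X n \<in> diff_points J g - N" for X :: "nat \<Rightarrow> real"
    using that deriv dp(2) by blast
  then show ?thesis
    unfolding clarke_subdifferential_def dp(1)
    by (intro arg_cong[where f = "\<lambda>S. convex hull S"] Collect_cong ex_cong1 conj_cong refl) simp
qed

section \<open>Density of the Clarke exhaustive functions\<close>

lemma exhaustive_approximation:
  fixes f :: "real \<Rightarrow> real"
  assumes J: "open J" "J \<noteq> {}" and "0 \<le> k" "0 < \<epsilon>" and N: "N \<in> null_sets lebesgue"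
    and lip: "\<And>x y. x \<in> J \<Longrightarrow> y \<in> J \<Longrightarrow> \<bar>f x - f y\<bar> \<le> k * \<bar>x - y\<bar>"
  obtains G G' where "\<And>t. (G has_real_derivative G' t) (at t)" "\<And>t. \<bar>G' t\<bar> \<le> k"
    "\<And>t. t \<in> J \<Longrightarrow> \<bar>G t - f t\<bar> \<le> \<epsilon>"
    "\<And>a b. -k \<le> a \<Longrightarrow> a \<le> b \<Longrightarrow> b \<le> k \<Longrightarrow> \<exists>x\<in>J. clarke_subdifferential N J G x = {a..b}"
proof -
  obtain F where F: "\<And>x. x \<in> J \<Longrightarrow> F x = f x" "\<And>s t. \<bar>F s - F t\<bar> \<le> k * \<bar>s - t\<bar>"
    using real_lipschitz_extension[OF J(2) \<open>0 \<le> k\<close> lip] by metis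
  have "0 < \<epsilon> / 3" using \<open>0 < \<epsilon>\<close> by simp
  obtain G0 g0 where G0: "\<And>x. (G0 has_real_derivative g0 x) (at x)" "continuous_on UNIV g0"
    "\<And>x. \<bar>g0 x\<bar> \<le> k" "\<And>x. \<bar>G0 x - F x\<bar> \<le> \<epsilon> / 3"
    using real_lipschitz_smoothing[OF \<open>0 \<le> k\<close> F(2) \<open>0 < \<epsilon> / 3\<close>] by metis
  obtain x0 where "x0 \<in> J" using J(2) by blast
  then obtain d where "0 < d" and d: "ball x0 d \<subseteq> J"
    using J(1) openE by blast
  \<comment> \<open>The derivative changes by at most \<open>2 * k\<close> on an interval of length
    \<open>4 * \<eta>\<close>. This costs at most a third of the error; smoothing and oscillation
    take the other two.\<close>
  define \<eta> where "\<eta> = min (d / 2) (\<epsilon> / (24 * (k + 1)))"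
  have \<eta>: "0 < \<eta>" "\<eta> < d" using \<open>0 < d\<close> \<open>0 < \<epsilon>\<close> \<open>0 \<le> k\<close> by (auto simp: \<eta>_def)
  have k\<eta>: "8 * k * \<eta> \<le> \<epsilon> / 3"
  proof -
    have "\<eta> \<le> \<epsilon> / (24 * (k + 1))" by (simp add: \<eta>_def)
    then have "24 * (k + 1) * \<eta> \<le> \<epsilon>" using \<open>0 \<le> k\<close> by (simp add: field_simps)
    then show ?thesis using \<eta> by (simp add: algebra_simps)
  qed
  \<comment> \<open>The cutoff is 1 within distance \<open>\<eta>\<close> of \<open>x0\<close> and 0
    beyond \<open>2 * \<eta>\<close>. It blends \<open>g0\<close> with Schoenberg's coordinates
    rescaled to [-k, k].\<close>
  define \<phi> where "\<phi> t = max 0 (min 1 (2 - \<bar>t - x0\<bar> / \<eta>))" for t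
  define A where "A i t = k * (2 * schoenberg i ((t - x0) / \<eta>) - 1)" for i t
  define \<alpha> where "\<alpha> i t = (1 - \<phi> t) * g0 t + \<phi> t * A i t" for i t
  define m where "m t = (\<alpha> 0 t + \<alpha> 1 t) / 2" for t
  define r where "r t = \<bar>\<alpha> 0 t - \<alpha> 1 t\<bar> / 2" for t
  have A_bound: "\<bar>A i t\<bar> \<le> k" for i t
  proof -
    have "\<bar>A i t\<bar> = k * \<bar>2 * schoenberg i ((t - x0) / \<eta>) - 1\<bar>"
      using \<open>0 \<le> k\<close> by (simp add: A_def abs_mult)
    also have "\<dots> \<le> k * 1"
      using schoenberg_bounds[of i "(t - x0) / \<eta>"] \<open>0 \<le> k\<close>
      by (intro mult_left_mono) (auto simp: abs_le_iff)
    finally show ?thesis by simp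
  qed
  have \<alpha>_bound: "\<bar>\<alpha> i t\<bar> \<le> k" for i t
  proof -
    have "\<phi> t \<in> {0..1}" by (auto simp: \<phi>_def)
    then have "(1 - \<phi> t) * g0 t + \<phi> t * A i t \<in> {-k..k}"
      using G0(3)[of t] A_bound[of i t]
      by (intro convexD[OF convex_real_interval(5), unfolded real_scaleR_def]) (auto simp: abs_le_iff)
    then show ?thesis by (auto simp: \<alpha>_def abs_le_iff)
  qed
  have cont_\<alpha>: "continuous_on UNIV (\<alpha> i)" for i
    unfolding \<alpha>_def \<phi>_def A_def
    by (intro continuous_intros G0(2) continuous_on_compose2[OF continuous_schoenberg]) (use \<eta> in auto)
  have cont_m: "continuous_on UNIV m" and cont_r: "continuous_on UNIV r"
    unfolding m_def r_def by (intro continuous_intros cont_\<alpha>; simp)+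
  have m_near: "\<bar>m t - g0 t\<bar> \<le> 2 * k" for t
    using \<alpha>_bound[of 0 t] \<alpha>_bound[of 1 t] G0(3)[of t] unfolding m_def abs_le_iff by argo
  have m_same: "m t = g0 t" if "t \<notin> {x0 - 2 * \<eta>..x0 + 2 * \<eta>}" for t
  proof -
    have "2 * \<eta> \<le> \<bar>t - x0\<bar>" using that by auto
    then have "\<phi> t = 0" using \<eta> by (simp add: \<phi>_def field_simps)
    then show ?thesis by (simp add: m_def \<alpha>_def)
  qed
  have p_le_q: "x0 - 2 * \<eta> \<le> x0 + 2 * \<eta>"
    and len: "2 * k * (x0 + 2 * \<eta> - (x0 - 2 * \<eta>)) = 8 * k * \<eta>"
    using \<eta> by (auto simp: algebra_simps)
  obtain M where M: "\<And>x. (M has_real_derivative m x) (at x)" "\<And>x. \<bar>M x - G0 x\<bar> \<le> 8 * k * \<eta>"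
    using antiderivative_local_perturbation[OF G0(1) cont_m m_near m_same p_le_q] unfolding len
    by metis
  \<comment> \<open>In the coordinate s = (t - x0) / \<open>\<eta>\<close> the Cantor set has its
    standard size. Multiplying \<open>h\<close> by \<open>\<eta>\<close> on the way back preserves
    slopes, whence the bound \<open>\<epsilon> / (3 * \<eta>)\<close>.\<close>
  define R where "R s = r (x0 + \<eta> * s)" for s
  have cont_R: "continuous_on UNIV R"
    unfolding R_def by (intro continuous_intros continuous_on_compose2[OF cont_r]) auto
  have R_bound: "0 \<le> R s \<and> R s \<le> k" for s
    using \<alpha>_bound[of 0 "x0 + \<eta> * s"] \<alpha>_bound[of 1 "x0 + \<eta> * s"] unfolding R_def r_def by argo
  have "0 < \<epsilon> / (3 * \<eta>)" using \<open>0 < \<epsilon>\<close> \<eta> by simp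
  obtain h h' where h: "\<And>t. (h has_real_derivative h' t) (at t)" "\<And>t. \<bar>h t\<bar> \<le> \<epsilon> / (3 * \<eta>)"
      "\<And>t. \<bar>h' t\<bar> \<le> R t"
    and h_osc: "\<And>i \<sigma>. i \<in> ternary_gaps \<Longrightarrow> \<sigma> \<in> {-1, 1} \<Longrightarrow>
       \<exists>t\<in>ball (gap_center i) (gap_radius i). isCont h' t \<and> R (gap_center i) - gap_radius i \<le> \<sigma> * h' t"
    using ternary.oscillation_exists[OF cont_R R_bound \<open>0 < \<epsilon> / (3 * \<eta>)\<close>] by metis
  define G where "G t = M t + \<eta> * h ((t - x0) / \<eta>)" for t
  define G' where "G' t = m t + h' ((t - x0) / \<eta>)" for t
  have G: "(G has_real_derivative G' t) (at t)" for t
  proof -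
    have "((\<lambda>t. (t - x0) / \<eta>) has_real_derivative 1 / \<eta>) (at t)"
      using \<eta> by (auto intro!: derivative_eq_intros)
    from DERIV_add[OF M(1) DERIV_cmult[OF DERIV_chain2[OF h(1) this]], of \<eta>]
    show ?thesis unfolding G_def G'_def using \<eta> by simp
  qed
  have r_eq: "R ((t - x0) / \<eta>) = r t" for t using \<eta> by (simp add: R_def)
  have G'_bounds: "m t - r t \<le> G' t \<and> G' t \<le> m t + r t" for t
    using h(3)[of "(t - x0) / \<eta>"] unfolding r_eq G'_def by (simp add: abs_le_iff)
  show ?thesis
  proof
    show "(G has_real_derivative G' t) (at t)" for t by (rule G)
    \<comment> \<open>\<open>m + r\<close> and \<open>m - r\<close> are the maximum and the minimum
      of the two functions \<open>\<alpha> i\<close>, which take values in [-k, k].\<close>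
    show "\<bar>G' t\<bar> \<le> k" for t
      using G'_bounds[of t] \<alpha>_bound[of 0 t] \<alpha>_bound[of 1 t] unfolding m_def r_def by argo
    show "\<bar>G t - f t\<bar> \<le> \<epsilon>" if "t \<in> J" for t
    proof -
      have "\<bar>\<eta> * h ((t - x0) / \<eta>)\<bar> = \<eta> * \<bar>h ((t - x0) / \<eta>)\<bar>"
        using \<eta> by (simp add: abs_mult)
      also have "\<dots> \<le> \<eta> * (\<epsilon> / (3 * \<eta>))"
        using \<eta> by (intro mult_left_mono h(2)) auto
      finally have "\<bar>\<eta> * h ((t - x0) / \<eta>)\<bar> \<le> \<eta> * (\<epsilon> / (3 * \<eta>))" .
      then have "\<bar>\<eta> * h ((t - x0) / \<eta>)\<bar> \<le> \<epsilon> / 3" using \<eta> by simp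
      then show ?thesis
        using M(2)[of t] k\<eta> G0(4)[of t] F(1)[OF that] unfolding G_def by linarith
    qed
  next
    fix a b assume ab: "-k \<le> a" "a \<le> b" "b \<le> k"
    \<comment> \<open>For \<open>k = 0\<close> the witness is 1/2, as division by 0 yields 0, and
      \<open>y = 0\<close>.\<close>
    have "\<exists>u\<in>{0..1}. k * (2 * u - 1) = y" if "-k \<le> y" "y \<le> k" for y
      using that \<open>0 \<le> k\<close> by (intro bexI[of _ "(y / k + 1) / 2"]) (cases "k = 0"; auto simp: field_simps)+
    then obtain u v where uv: "u \<in> {0..1}" "v \<in> {0..1}" "k * (2 * u - 1) = a" "k * (2 * v - 1) = b"
      using ab by (meson order_trans)
    obtain \<beta> x where x: "cantor_point \<beta> x" "schoenberg 0 x = u" "schoenberg 1 x = v"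
      using schoenberg_surj[OF uv(1,2)] by blast
    define X where "X = x0 + \<eta> * x"
    have Xx: "(X - x0) / \<eta> = x" using \<eta> by (simp add: X_def)
    have x01: "0 \<le> x" "x \<le> 1" using cantor_point_unit[OF x(1)] by auto
    have "0 \<le> \<eta> * x" "\<eta> * x \<le> \<eta>" using x01 \<eta> by (simp_all add: mult_left_le)
    then have "X \<in> ball x0 d" using \<eta> unfolding X_def mem_ball dist_real_def by linarith
    then have "X \<in> J" using d by blast
    have "\<phi> X = 1" using Xx x01 \<eta> by (simp add: \<phi>_def X_def abs_mult)
    then have \<alpha>X: "\<alpha> 0 X = a" "\<alpha> 1 X = b"
      using x uv unfolding \<alpha>_def A_def Xx by simp_all
    then have mr: "m X - r X = a" "m X + r X = b"
      using ab by (auto simp: m_def r_def field_simps)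
    have isCont: "isCont m t" "isCont r t" "isCont R s" for t s
      using cont_m cont_r cont_R by (auto simp: continuous_on_eq_continuous_at)
    \<comment> \<open>The sign treats both ends at once: 1 gives the upper end of the interval, -1
      the lower one.\<close>
    have near: "\<exists>t. \<bar>t - X\<bar> < \<delta> \<and> isCont G' t \<and> \<sigma> * m X + r X - \<delta> \<le> \<sigma> * G' t"
      if "0 < \<delta>" and \<sigma>: "\<sigma> \<in> {-1, 1}" for \<delta> \<sigma> :: real
    proof -
      have \<delta>4: "0 < \<delta> / 4" using \<open>0 < \<delta>\<close> by simp
      obtain d1 where d1: "d1 > 0" "\<And>t. \<bar>t - X\<bar> < d1 \<Longrightarrow> \<bar>m t - m X\<bar> < \<delta> / 4"
        using isCont(1)[of X] \<delta>4 unfolding continuous_at_eps_delta dist_real_def by blast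
      obtain d2 where d2: "d2 > 0" "\<And>t. \<bar>t - x\<bar> < d2 \<Longrightarrow> \<bar>R t - R x\<bar> < \<delta> / 4"
        using isCont(3)[of x] \<delta>4 unfolding continuous_at_eps_delta dist_real_def by blast
      \<comment> \<open>The losses in \<open>m\<close>, in \<open>R\<close> and in the gap radius
        are at most \<open>\<delta> / 4\<close> each. The last bound accounts for \<open>s\<close>
        being within \<open>2 * e\<close> of \<open>x\<close> before rescaling by
        \<open>\<eta>\<close>.\<close>
      define e where "e = Min {d2, \<delta> / 4, min d1 \<delta> / (2 * \<eta>)}"
      have "0 < e" using d1 d2 \<open>0 < \<delta>\<close> \<eta> by (auto simp: e_def)
      have e: "e \<le> d2" "e \<le> \<delta> / 4" "e \<le> min d1 \<delta> / (2 * \<eta>)"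
        unfolding e_def by (intro Min_le; simp)+
      obtain i where i: "i \<in> ternary_gaps" "gap_radius i < e" "\<bar>gap_center i - x\<bar> < e"
        using gaps_accumulate_at_cantor_point[OF x(1) \<open>0 < e\<close>] by blast
      obtain s where s: "s \<in> ball (gap_center i) (gap_radius i)" "isCont h' s"
        "R (gap_center i) - gap_radius i \<le> \<sigma> * h' s"
        using h_osc[OF i(1) \<sigma>] by blast
      define t where "t = x0 + \<eta> * s"
      have ts: "(t - x0) / \<eta> = s" using \<eta> by (simp add: t_def)
      have "\<bar>s - x\<bar> < 2 * e" using s(1) i(2,3) by (auto simp: dist_real_def)
      then have "\<eta> * \<bar>s - x\<bar> < \<eta> * (2 * e)" using \<eta> by simp
      also have "\<dots> \<le> min d1 \<delta>" using e(3) \<eta> by (simp add: field_simps)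
      finally have "\<bar>\<eta> * (s - x)\<bar> < min d1 \<delta>" using \<eta> by (simp add: abs_mult)
      then have tX: "\<bar>t - X\<bar> < min d1 \<delta>" by (simp add: t_def X_def right_diff_distrib)
      have "isCont (\<lambda>t. h' ((t - x0) / \<eta>)) t"
        by (rule isCont_o2[where f = "\<lambda>t. (t - x0) / \<eta>"]) (use \<eta> ts s in \<open>auto intro!: continuous_intros\<close>)
      then have contG': "isCont G' t"
        unfolding G'_def by (intro isCont_add isCont(1))
      have "\<bar>R (gap_center i) - R x\<bar> < \<delta> / 4" "\<bar>m t - m X\<bar> < \<delta> / 4"
        using d1(2) d2(2) tX i(3) e(1) by auto
      moreover have "R x = r X" using r_eq[of X] Xx by simp
      moreover have "\<sigma> * m X - \<delta> / 4 \<le> \<sigma> * m t"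
      proof -
        have "\<sigma> = -1 \<or> \<sigma> = 1" using \<sigma> by auto
        then show ?thesis
          using \<open>\<bar>m t - m X\<bar> < \<delta> / 4\<close> by (elim disjE) (hypsubst, linarith)+
      qed
      moreover have "\<sigma> * G' t = \<sigma> * m t + \<sigma> * h' s" by (simp add: G'_def ts distrib_left)
      ultimately have "\<sigma> * m X + r X - \<delta> \<le> \<sigma> * G' t"
        using s(3) i(2) e(2) by linarith
      then show ?thesis using contG' tX by auto
    qed
    have "clarke_subdifferential N J G X = {m X - r X..m X + r X}"
    proof (rule clarke_subdifferential_eq_interval[OF J(1) \<open>X \<in> J\<close> N G G'_bounds])
      show "isCont (\<lambda>t. m t - r t) X" "isCont (\<lambda>t. m t + r t) X"
        by (intro continuous_intros isCont)+
      show "\<exists>t. \<bar>t - X\<bar> < \<delta> \<and> isCont G' t \<and> m X + r X - \<delta> \<le> G' t" if "0 < \<delta>" for \<delta>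
        using near[OF that, of 1] by simp
      show "\<exists>t. \<bar>t - X\<bar> < \<delta> \<and> isCont G' t \<and> G' t \<le> m X - r X + \<delta>" if "0 < \<delta>" for \<delta>
        using near[OF that, of "-1"] by (auto simp: algebra_simps)
    qed
    then show "\<exists>x\<in>J. clarke_subdifferential N J G x = {a..b}"
      using \<open>X \<in> J\<close> mr by auto
  qed
qed

section \<open>The Lipschitz norm and the density theorem\<close>

lemma lip_norm_bound:
  assumes "C-lipschitz_on J f" "x \<in> J" "y \<in> J"
  shows "\<bar>f x - f y\<bar> \<le> lip_norm J f * \<bar>x - y\<bar>"
proof (cases "x = y")
  case False
  have bdd: "bdd_above ((\<lambda>(x, y). \<bar>f x - f y\<bar> / \<bar>x - y\<bar>) ` {(x, y). x \<in> J \<and> y \<in> J \<and> x \<noteq> y})"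
    using lipschitz_onD[OF assms(1)]
    by (intro bdd_aboveI2[of _ _ C]) (auto simp: dist_real_def field_simps)
  have "\<bar>f x - f y\<bar> / \<bar>x - y\<bar> \<le> lip_norm J f"
    unfolding lip_norm_def using cSUP_upper[OF _ bdd, of "(x, y)"] assms False by simp
  then show ?thesis using False by (simp add: field_simps)
qed simp

lemma lip_norm_le:
  fixes J :: "real set"
  assumes "open J" "J \<noteq> {}" and "\<And>x y. x \<in> J \<Longrightarrow> y \<in> J \<Longrightarrow> \<bar>f x - f y\<bar> \<le> k * \<bar>x - y\<bar>"
  shows "lip_norm J f \<le> k"
  unfolding lip_norm_def
proof (rule cSUP_least)
  \<comment> \<open>A nonempty open set is not a singleton, so the supremum is over a nonempty set
    of pairs.\<close>
  obtain x where "x \<in> J" using assms(2) by blast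
  moreover have "J \<noteq> {x}" using assms(1) not_open_singleton by blast
  ultimately show "{(x, y). x \<in> J \<and> y \<in> J \<and> x \<noteq> y} \<noteq> {}" by blast
qed (use assms(3) in \<open>auto simp: field_simps\<close>)

theorem mainTheorem4:
  fixes J N :: "real set" and k :: real
  assumes "open J" and "is_interval J" and "J \<noteq> {}"
    and "k \<ge> 0"
    and "N \<in> null_sets lebesgue"
  shows "mtopology_of (Lip_metric k J) closure_of
           {f \<in> Lip_set k J. (\<forall>x\<in>J. f differentiable (at x)) \<and> clarke_exhaustive N J f}
         = mspace (Lip_metric k J)"
proof -
  let ?S = "{f \<in> Lip_set k J. (\<forall>x\<in>J. f differentiable (at x)) \<and> clarke_exhaustive N J f}"
  have dense: "\<exists>g\<in>?S. mdist (Lip_metric k J) f g < e" if f: "f \<in> Lip_set k J" and "0 < e" for f e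
  proof -
    have f_lip: "\<bar>f x - f y\<bar> \<le> k * \<bar>x - y\<bar>" if "x \<in> J" "y \<in> J" for x y
    proof -
      obtain C where "C-lipschitz_on J f" and "lip_norm J f \<le> k" using f by (auto simp: Lip_set_def)
      then show ?thesis
        using lip_norm_bound[OF _ that] mult_right_mono[of "lip_norm J f" k "\<bar>x - y\<bar>"]
        by (meson abs_ge_zero order_trans)
    qed
    \<comment> \<open>A pointwise bound gives only a weak inequality for the supremum;
      \<open>e / 2\<close> makes it strict.\<close>
    have "0 < e / 2" using \<open>0 < e\<close> by simp
    obtain G G' where G: "\<And>t. (G has_real_derivative G' t) (at t)" "\<And>t. \<bar>G' t\<bar> \<le> k"
      and G_near: "\<And>t. t \<in> J \<Longrightarrow> \<bar>G t - f t\<bar> \<le> e / 2"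
      and G_clarke: "\<And>a b. -k \<le> a \<Longrightarrow> a \<le> b \<Longrightarrow> b \<le> k \<Longrightarrow> \<exists>x\<in>J. clarke_subdifferential N J G x = {a..b}"
      using exhaustive_approximation[OF assms(1,3,4) \<open>0 < e / 2\<close> assms(5) f_lip] by metis
    define g where "g = restrict G J"
    have g_eq: "g t = G t" if "t \<in> J" for t using that by (simp add: g_def)
    have g_lip: "\<bar>g x - g y\<bar> \<le> k * \<bar>x - y\<bar>" if "x \<in> J" "y \<in> J" for x y
    proof -
      have "norm (G x - G y) \<le> k * norm (x - y)"
        by (rule field_differentiable_bound[of UNIV _ G']) (use G in auto)
      then show ?thesis using g_eq that by simp
    qed
    have g_lip_on: "k-lipschitz_on J g"
      using g_lip \<open>k \<ge> 0\<close> by (intro lipschitz_onI) (auto simp: dist_real_def)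
    have g_norm: "lip_norm J g \<le> k"
      by (rule lip_norm_le[OF assms(1,3) g_lip])
    have "bounded (g ` J)"
    proof -
      obtain B where "\<And>t. t \<in> J \<Longrightarrow> \<bar>f t\<bar> \<le> B" using f by (auto simp: Lip_set_def bounded_iff)
      then have "\<bar>g t\<bar> \<le> B + e / 2" if "t \<in> J" for t
        using G_near[OF that] g_eq[OF that] that by (smt (verit))
      then show ?thesis unfolding bounded_iff by auto
    qed
    then have g: "g \<in> Lip_set k J"
      using g_lip_on g_norm by (auto simp: Lip_set_def g_def)
    have "clarke_exhaustive N J g"
      unfolding clarke_exhaustive_def
    proof (intro conjI allI impI)
      fix K assume K: "K \<noteq> {} \<and> closed K \<and> convex K \<and> K \<subseteq> {- lip_norm J g..lip_norm J g}"
      then have "compact K" "connected K"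
        by (auto simp: compact_eq_bounded_closed convex_connected intro: bounded_subset[OF bounded_closed_interval])
      then obtain a b where ab: "K = {a..b}" using connected_compact_interval_1 by blast
      then have "a \<le> b" using K by auto
      \<comment> \<open>All subintervals of [-k, k] are available, so
        \<open>lip_norm J g <= k\<close> suffices and the exact norm need not be computed.\<close>
      then have "-k \<le> a" "b \<le> k" using K ab g_norm by auto
      then show "\<exists>x\<in>J. clarke_subdifferential N J g x = K"
        using G_clarke[OF _ \<open>a \<le> b\<close>] clarke_subdifferential_cong[OF \<open>open J\<close> g_eq] ab by auto
    qed (use g_lip_on in blast)
    moreover have "g differentiable (at x)" if "x \<in> J" for x
    proof -
      have "(g has_real_derivative G' x) (at x)"
        using g_eq by (intro has_field_derivative_transform_within_open[OF G(1) \<open>open J\<close> that]) auto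
      then show ?thesis by (auto simp: real_differentiable_def)
    qed
    ultimately have "g \<in> ?S" using g by blast
    moreover have "mdist (Lip_metric k J) f g \<le> e / 2"
      unfolding mdist_Lip_metric[OF assms(3) f g]
      by (rule cSUP_least[OF assms(3)]) (use G_near g_eq in \<open>simp add: abs_minus_commute\<close>)
    ultimately show ?thesis using \<open>0 < e\<close> by (intro bexI[of _ g]) auto
  qed
  interpret Metric_space "Lip_set k J" "mdist (Lip_metric k J)"
    using Metric_space_mspace_mdist[of "Lip_metric k J"] by (simp add: mspace_Lip_metric)
  have "\<exists>g\<in>?S. g \<in> mball f e" if "f \<in> Lip_set k J" "0 < e" for f e
    using dense[OF that] that(1) unfolding in_mball by blast
  then show ?thesis
    unfolding mtopology_of_def mspace_Lip_metric metric_closure_of by blast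
qed

end
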